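(* Let $\Phi$ be a nested family of standard tests for $H_0$ such that every $\phi\in\Phi$ is an unbiased test. Assume that $\Theta$ is a connected space and that, for every $t$, $\mathbb{P}_\theta(p_{H_0,\Phi}(X)\le t)$ is a continuous function of $\theta$. Let $p=p_{H_0,\Phi}$ and let $\alpha,\beta\in[0,1]$ with $\alpha+\beta\le1$. Then the test $$\phi_{1-p,\beta,1-\alpha}(x)=\begin{cases}0,&\text{if }p(x)\ge1-\beta,\\1,&\text{if }p(x)<\alpha,\\\tfrac12,&\text{otherwise,}\end{cases}$$ is an $(\alpha,\beta)$-level test for $H_0$.
   Context: Setting: $X$ is the data, taking values in the sample space $\mathcal{X}$; $\mathbb{P}_\theta$ is the distribution of $X$ when the parameter is $\theta\in\Theta$ ($\Theta$ a topological space); the null hypothesis is a subset $H_0\subset\Theta$ and $H_1=\Theta\setminus H_0$. An agnostic test is a function $\phi:\mathcal{X}\to\{0,\tfrac12,1\}$ ($0$ = accept $H_0$, $1$ = reject $H_0$, $\tfrac12$ = remain agnostic). It is a standard test if its image is $\{0,1\}$. Put $\alpha_\phi:=\sup_{\theta_0\in H_0}\mathbb{P}_{\theta_0}(\phi=1)$ and $\beta_\phi:=\sup_{\theta_1\in H_1}\mathbb{P}_{\theta_1}(\phi=0)$. The test has $(\alpha,\beta)$-level if $\alpha_\phi=\alpha$ and $\beta_\phi=\beta$. It is unbiased if $\inf_{\theta_0\in H_0}\mathbb{P}_{\theta_0}(\phi=0)\ge\beta_\phi$ and $\inf_{\theta_1\in H_1}\mathbb{P}_{\theta_1}(\phi=1)\ge\alpha_\phi$.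 A nested family of standard tests for $H_0$ is a set $\Phi$ such that: every $\phi\in\Phi$ is a standard test; the map $g:\Phi\to[0,1]$, $g(\phi)=\alpha_\phi$, is bijective; and if $\phi_1,\phi_2\in\Phi$ with $\alpha_{\phi_1}\le\alpha_{\phi_2}$ then $\{x\in\mathcal{X}:\phi_1(x)=1\}\subset\{x\in\mathcal{X}:\phi_2(x)=1\}$. The p-value of $\Phi$ against $H_0$ is $p_{H_0,\Phi}:\mathcal{X}\to[0,1]$, $p_{H_0,\Phi}(x)=\inf\{\alpha_\phi:\phi\in\Phi,\ \phi(x)=1\}$. *)

theory Defs
  imports "HOL-Probability.Probability"
begin

text \<open>
  The sample space is a measurable space \<open>M\<close>, and \<open>P \<theta>\<close> is the distribution of the data
  on it. Tests are measurable, so that their error probabilities make sense. Values of a test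
  outside \<open>space M\<close> are irrelevant.
\<close>

definition agnostic_test :: "'x measure \<Rightarrow> ('x \<Rightarrow> real) \<Rightarrow> bool" where
  "agnostic_test M \<phi> \<longleftrightarrow> \<phi> \<in> measurable M (count_space {0, 1/2, 1})"

definition standard_test :: "'x measure \<Rightarrow> ('x \<Rightarrow> real) \<Rightarrow> bool" where
  "standard_test M \<phi> \<longleftrightarrow> agnostic_test M \<phi> \<and> \<phi> ` space M = {0, 1}"

text \<open>
  The suprema and infima below are those of the conditionally complete lattice of reals, hence
  meaningful only over nonempty hypotheses. If \<open>H0\<close> is empty, \<open>type_I_size\<close> is constant
  and no nested family exists.
\<close>

definition type_I_size :: "('t \<Rightarrow> 'x measure) \<Rightarrow> 't set \<Rightarrow> ('x \<Rightarrow> real) \<Rightarrow> real" where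
  "type_I_size P H0 \<phi> = (SUP \<theta>\<in>H0. \<P>(x in P \<theta>. \<phi> x = 1))"

definition type_II_size :: "('t \<Rightarrow> 'x measure) \<Rightarrow> 't set \<Rightarrow> ('x \<Rightarrow> real) \<Rightarrow> real" where
  "type_II_size P H1 \<phi> = (SUP \<theta>\<in>H1. \<P>(x in P \<theta>. \<phi> x = 0))"

definition level_test ::
    "'x measure \<Rightarrow> ('t \<Rightarrow> 'x measure) \<Rightarrow> 't set \<Rightarrow> 't set \<Rightarrow> real \<Rightarrow> real \<Rightarrow> ('x \<Rightarrow> real) \<Rightarrow> bool" where
  "level_test M P H0 H1 \<alpha> \<beta> \<phi> \<longleftrightarrow>
     agnostic_test M \<phi> \<and> type_I_size P H0 \<phi> = \<alpha> \<and> type_II_size P H1 \<phi> = \<beta>"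

definition unbiased_test ::
    "('t \<Rightarrow> 'x measure) \<Rightarrow> 't set \<Rightarrow> 't set \<Rightarrow> ('x \<Rightarrow> real) \<Rightarrow> bool" where
  "unbiased_test P H0 H1 \<phi> \<longleftrightarrow>
     (INF \<theta>\<in>H0. \<P>(x in P \<theta>. \<phi> x = 0)) \<ge> type_II_size P H1 \<phi> \<and>
     (INF \<theta>\<in>H1. \<P>(x in P \<theta>. \<phi> x = 1)) \<ge> type_I_size P H0 \<phi>"

definition nested_family ::
    "'x measure \<Rightarrow> ('t \<Rightarrow> 'x measure) \<Rightarrow> 't set \<Rightarrow> ('x \<Rightarrow> real) set \<Rightarrow> bool" where
  "nested_family M P H0 \<Phi> \<longleftrightarrow>
     (\<forall>\<phi>\<in>\<Phi>. standard_test M \<phi>) \<and>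
     bij_betw (type_I_size P H0) \<Phi> {0..1} \<and>
     (\<forall>\<phi>1\<in>\<Phi>. \<forall>\<phi>2\<in>\<Phi>. type_I_size P H0 \<phi>1 \<le> type_I_size P H0 \<phi>2 \<longrightarrow>
        {x \<in> space M. \<phi>1 x = 1} \<subseteq> {x \<in> space M. \<phi>2 x = 1})"

text \<open>
  The p-value is an infimum taken in the unit interval, where the infimum of the empty set is 1.
  Inserting 1 encodes this; it leaves the infimum of a nonempty set of sizes unchanged, as sizes
  of tests in a nested family are at most 1.
\<close>

definition p_value :: "('t \<Rightarrow> 'x measure) \<Rightarrow> 't set \<Rightarrow> ('x \<Rightarrow> real) set \<Rightarrow> 'x \<Rightarrow> real" where
  "p_value P H0 \<Phi> x = Inf (insert 1 {type_I_size P H0 \<phi> | \<phi>. \<phi> \<in> \<Phi> \<and> \<phi> x = 1})"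

end

theory Submission
  imports Defs
begin

text \<open>
  Let \<open>R\<^sub>t\<close> be the rejection region of the test of size \<open>t\<close>. Then
  \<open>{p < t} \<subseteq> R\<^sub>t \<subseteq> {p \<le> t}\<close>, so on \<open>H0\<close> the probability of
  \<open>{p < \<alpha>}\<close> is squeezed between those of \<open>R\<^sub>s\<close>, \<open>s < \<alpha>\<close>, and of
  \<open>R\<^sub>\<alpha>\<close>; its supremum is \<open>\<alpha>\<close>. For the type II error, unbiasedness gives
  \<open>P \<theta> {p < t} \<ge> t\<close> on \<open>H1\<close>, whereas \<open>P \<theta> {p \<le> t} \<le> t\<close> on \<open>H0\<close> for
  \<open>t < 1\<close>. If \<open>P \<theta> {p \<le> t}\<close> stayed above some \<open>t + e\<close> on \<open>H1\<close>, continuity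
  would make \<open>H0\<close> and \<open>H1\<close> a separation of the connected parameter space.
\<close>

section \<open>Connectedness of the parameter space\<close>

lemma connected_space_near_bound:
  fixes f :: "'t \<Rightarrow> real"
  assumes "connected_space X" and cont: "continuous_map X euclideanreal f"
    and "A \<subseteq> topspace X" "A \<noteq> {}" "A \<noteq> topspace X"
    and bound: "\<And>x. x \<in> A \<Longrightarrow> f x \<le> t" and "e > 0"
  shows "\<exists>x \<in> topspace X - A. f x < t + e"
proof (rule ccontr)
  assume "\<not> ?thesis"
  then have above: "f x \<ge> t + e" if "x \<in> topspace X - A" for x
    using that by (meson not_less)
  \<comment> \<open>The gap between \<open>t\<close> and \<open>t + e\<close> lets \<open>A\<close>
    be cut out by a closed condition on \<open>f\<close> and also by an open one, so
    \<open>A\<close> is clopen.\<close>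
  have iff: "x \<in> A \<longleftrightarrow> f x \<le> t" "x \<in> A \<longleftrightarrow> f x < t + e" if "x \<in> topspace X" for x
    using bound[of x] above[of x] that \<open>e > 0\<close> by (cases "x \<in> A"; simp)+
  have "A = {x \<in> topspace X. f x \<in> {..t}}"
    using assms(3) iff(1) by blast
  then have cl: "closedin X A"
    using closedin_continuous_map_preimage[OF cont, of "{..t}"] by simp
  have "A = {x \<in> topspace X. f x \<in> {..<t + e}}"
    using assms(3) iff(2) by blast
  then have "openin X A"
    using openin_continuous_map_preimage[OF cont, of "{..<t + e}"] by simp
  with cl assms(1,4,5) show False
    unfolding connected_space_clopen_in by blast
qed

section \<open>Sizes of tests in a nested family\<close>

lemma nested_familyE:
  assumes "nested_family M P H0 \<Phi>" "t \<in> {0..1}"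
  obtains \<phi> where "\<phi> \<in> \<Phi>" "type_I_size P H0 \<phi> = t"
proof -
  have "t \<in> type_I_size P H0 ` \<Phi>"
    using assms by (simp add: nested_family_def bij_betw_def)
  with that show thesis by blast
qed

lemma nested_family_size:
  assumes "nested_family M P H0 \<Phi>" "\<phi> \<in> \<Phi>"
  shows "type_I_size P H0 \<phi> \<in> {0..1}"
  using assms unfolding nested_family_def bij_betw_def by blast

text \<open>Over an empty hypothesis the supremum is the same fixed real for every test, yet the
  sizes 0 and 1 both occur in the family.\<close>

lemma nested_family_nonempty:
  assumes "nested_family M P H0 \<Phi>"
  shows "H0 \<noteq> {}"
proof
  assume "H0 = {}"
  then have "type_I_size P H0 \<phi> = type_I_size P H0 \<psi>" for \<phi> \<psi>
    by (simp add: type_I_size_def)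
  moreover obtain \<phi> where "type_I_size P H0 \<phi> = 0"
    using nested_familyE[OF assms, of 0] by auto
  moreover obtain \<psi> where "type_I_size P H0 \<psi> = 1"
    using nested_familyE[OF assms, of 1] by auto
  ultimately show False
    by (metis zero_neq_one)
qed

lemma agnostic_test_sets:
  assumes "agnostic_test M \<phi>"
  shows "{x \<in> space M. \<phi> x = c} \<in> sets M"
proof -
  \<comment> \<open>Intersecting with the three admissible values keeps the set inside the count
    space even when \<open>c\<close> is not one of them.\<close>
  have "\<phi> -` ({c} \<inter> {0, 1/2, 1}) \<inter> space M \<in> sets M"
    using assms unfolding agnostic_test_def by (rule measurable_sets) auto
  moreover have "\<phi> -` ({c} \<inter> {0, 1/2, 1}) \<inter> space M = {x \<in> space M. \<phi> x = c}"
    using measurable_space[OF assms[unfolded agnostic_test_def]] by auto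
  ultimately show ?thesis by simp
qed

section \<open>The p-value as a random variable\<close>

context
  fixes M :: "'x measure" and P :: "'t \<Rightarrow> 'x measure" and H0 \<Phi>
  assumes nested: "nested_family M P H0 \<Phi>"
begin

lemma p_value_bdd_below:
  "bdd_below (insert 1 {type_I_size P H0 \<phi> | \<phi>. \<phi> \<in> \<Phi> \<and> \<phi> x = 1})"
  using nested_family_size[OF nested] by (intro bdd_belowI[of _ 0]) auto

lemma p_value_nonneg: "0 \<le> p_value P H0 \<Phi> x"
  unfolding p_value_def
  using nested_family_size[OF nested] by (intro cInf_greatest) auto

lemma p_value_le_1: "p_value P H0 \<Phi> x \<le> 1"
  unfolding p_value_def by (rule cInf_lower[OF _ p_value_bdd_below]) simp

lemma p_value_le_size:
  assumes "\<phi> \<in> \<Phi>" "\<phi> x = 1"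
  shows "p_value P H0 \<Phi> x \<le> type_I_size P H0 \<phi>"
  unfolding p_value_def by (rule cInf_lower[OF _ p_value_bdd_below]) (use assms in auto)

lemma p_value_less_size_imp_reject:
  assumes "\<phi> \<in> \<Phi>" "x \<in> space M" "p_value P H0 \<Phi> x < type_I_size P H0 \<phi>"
  shows "\<phi> x = 1"
proof -
  obtain s where s: "s \<in> insert 1 {type_I_size P H0 \<psi> | \<psi>. \<psi> \<in> \<Phi> \<and> \<psi> x = 1}"
      "s < type_I_size P H0 \<phi>"
    using cInf_lessD[OF _ assms(3)[unfolded p_value_def]] by blast
  \<comment> \<open>Sizes are at most 1, so \<open>s < 1\<close>: the inserted element 1 is ruled
    out, and \<open>s\<close> is the size of a test rejecting at \<open>x\<close>. Nestedness then
    carries the rejection over to \<open>\<phi>\<close>.\<close>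
  then obtain \<psi> where "\<psi> \<in> \<Phi>" "\<psi> x = 1" "type_I_size P H0 \<psi> \<le> type_I_size P H0 \<phi>"
    using nested_family_size[OF nested assms(1)] by force
  then show ?thesis
    using nested assms(1,2) unfolding nested_family_def by blast
qed

lemma nested_family_sets:
  assumes "\<phi> \<in> \<Phi>"
  shows "{x \<in> space M. \<phi> x = c} \<in> sets M"
  using nested assms agnostic_test_sets
  unfolding nested_family_def standard_test_def by blast

text \<open>Density of the rationals writes \<open>{p < t}\<close> as a countable union of rejection
  regions, one for each rational size below \<open>t\<close>.\<close>

lemma p_value_measurable: "p_value P H0 \<Phi> \<in> borel_measurable M"
  unfolding borel_measurable_iff_less
proof
  fix t :: real
  show "{x \<in> space M. p_value P H0 \<Phi> x < t} \<in> sets M"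
  \<comment> \<open>For \<open>t > 1\<close> a rational below \<open>t\<close> may exceed 1 and then
    is not the size of any test.\<close>
  proof (cases "t > 1")
    case True
    then have "{x \<in> space M. p_value P H0 \<Phi> x < t} = space M"
      using p_value_le_1 by (auto intro: le_less_trans)
    then show ?thesis by simp
  next
    case False
    have "\<exists>\<phi>. \<phi> \<in> \<Phi> \<and> type_I_size P H0 \<phi> = s" if "s \<in> {0..1}" for s
      using nested_familyE[OF nested that] by metis
    then obtain \<phi> where \<phi>: "\<And>s. s \<in> {0..1} \<Longrightarrow> \<phi> s \<in> \<Phi> \<and> type_I_size P H0 (\<phi> s) = s"
      by metis
    let ?Q = "\<rat> \<inter> {0..<t}"
    have "{x \<in> space M. p_value P H0 \<Phi> x < t} = (\<Union>s\<in>?Q. {x \<in> space M. \<phi> s x = 1})"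
      (is "?L = ?R")
    proof (intro equalityI subsetI)
      fix x assume x: "x \<in> ?L"
      then obtain s where s: "s \<in> \<rat>" "p_value P H0 \<Phi> x < s" "s < t"
        using Rats_dense_in_real by blast
      with False p_value_nonneg[of x] have "s \<in> {0..1}" by auto
      moreover from this have "\<phi> s x = 1"
        using \<phi>[of s] x s by (intro p_value_less_size_imp_reject) auto
      ultimately show "x \<in> ?R" using x s by auto
    next
      fix x assume "x \<in> ?R"
      then obtain s where s: "s \<in> ?Q" "x \<in> space M" "\<phi> s x = 1" by blast
      then have "p_value P H0 \<Phi> x \<le> s"
        using \<phi>[of s] p_value_le_size[of "\<phi> s" x] False by auto
      with s show "x \<in> ?L" by auto
    qed
    moreover have "?R \<in> sets M"
    proof (rule sets.countable_UN'')
      show "countable ?Q" using countable_rat by blast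
      fix s assume "s \<in> ?Q"
      with False \<phi>[of s] show "{x \<in> space M. \<phi> s x = 1} \<in> sets M"
        by (intro nested_family_sets) auto
    qed
    ultimately show ?thesis by simp
  qed
qed

section \<open>Distribution of the p-value at a fixed parameter\<close>

context
  fixes \<theta>
  assumes prob: "prob_space (P \<theta>)" and sets: "sets (P \<theta>) = sets M"
begin

interpretation prob_space "P \<theta>" by (rule prob)

lemma p_value_events [measurable]: "p_value P H0 \<Phi> \<in> borel_measurable (P \<theta>)"
  unfolding measurable_cong_sets[OF sets refl] by (rule p_value_measurable)

lemma prob_reject_le_p_value_less:
  assumes "\<phi> \<in> \<Phi>" "type_I_size P H0 \<phi> < t"
  shows "\<P>(x in P \<theta>. \<phi> x = 1) \<le> \<P>(x in P \<theta>. p_value P H0 \<Phi> x < t)"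
proof (rule finite_measure_mono)
  show "{x \<in> space (P \<theta>). \<phi> x = 1} \<subseteq> {x \<in> space (P \<theta>). p_value P H0 \<Phi> x < t}"
    using p_value_le_size[OF assms(1)] assms(2) le_less_trans by fastforce
qed measurable

lemma prob_p_value_less_le_reject:
  assumes "\<phi> \<in> \<Phi>"
  shows "\<P>(x in P \<theta>. p_value P H0 \<Phi> x < type_I_size P H0 \<phi>) \<le> \<P>(x in P \<theta>. \<phi> x = 1)"
proof (rule finite_measure_mono)
  have "space (P \<theta>) = space M" using sets by (rule sets_eq_imp_space_eq)
  then show "{x \<in> space (P \<theta>). p_value P H0 \<Phi> x < type_I_size P H0 \<phi>}
      \<subseteq> {x \<in> space (P \<theta>). \<phi> x = 1}" "{x \<in> space (P \<theta>). \<phi> x = 1} \<in> events"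
    using p_value_less_size_imp_reject[OF assms] nested_family_sets[OF assms] sets by auto
qed

text \<open>Each test of size \<open>s < t\<close> rejects with probability at least
  \<open>s\<close>, and its rejection region lies in \<open>{p < t}\<close>; let \<open>s\<close>
  increase to \<open>t\<close>. The assumption \<open>reject\<close> is what unbiasedness supplies
  on \<open>H1\<close>.\<close>

lemma prob_p_value_less_ge:
  assumes reject: "\<And>\<phi>. \<phi> \<in> \<Phi> \<Longrightarrow> type_I_size P H0 \<phi> \<le> \<P>(x in P \<theta>. \<phi> x = 1)"
    and "t \<le> 1"
  shows "t \<le> \<P>(x in P \<theta>. p_value P H0 \<Phi> x < t)"
proof (cases "t \<le> 0")
  case True
  then show ?thesis by (rule order_trans) (rule measure_nonneg)
next
  case False
  show ?thesis
  proof (rule dense_le_bounded[of 0])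
    fix s :: real assume s: "0 < s" "s < t"
    with assms(2) have "s \<in> {0..1}" by auto
    then obtain \<phi> where "\<phi> \<in> \<Phi>" "type_I_size P H0 \<phi> = s"
      by (rule nested_familyE[OF nested])
    with reject[of \<phi>] prob_reject_le_p_value_less[of \<phi> t] s
    show "s \<le> \<P>(x in P \<theta>. p_value P H0 \<Phi> x < t)"
      by linarith
  qed (use False in simp)
qed

lemma prob_p_value_less_le_null:
  assumes "\<theta> \<in> H0" and "\<And>\<theta>. \<theta> \<in> H0 \<Longrightarrow> prob_space (P \<theta>)" and "t \<in> {0..1}"
  shows "\<P>(x in P \<theta>. p_value P H0 \<Phi> x < t) \<le> t"
proof -
  obtain \<phi> where \<phi>: "\<phi> \<in> \<Phi>" "type_I_size P H0 \<phi> = t"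
    using assms(3) by (rule nested_familyE[OF nested])
  \<comment> \<open>The supremum dominates its members only when the family is bounded above, hence
    the appeal to probability measures on all of \<open>H0\<close>.\<close>
  have "\<P>(x in P \<theta>. \<phi> x = 1) \<le> type_I_size P H0 \<phi>"
    unfolding type_I_size_def using assms(1,2)
    by (intro cSUP_upper bdd_aboveI[of _ 1]) (auto intro: prob_space.prob_le_1)
  with prob_p_value_less_le_reject[OF \<phi>(1)] \<phi>(2) show ?thesis by simp
qed

text \<open>Enlarge \<open>{p \<le> t}\<close> to \<open>{p < s}\<close> with
  \<open>t < s < 1\<close>, apply the strict bound at \<open>s\<close>, and let \<open>s\<close>
  decrease to \<open>t\<close>.\<close>

lemma prob_p_value_le_null:
  assumes "\<theta> \<in> H0" and "\<And>\<theta>. \<theta> \<in> H0 \<Longrightarrow> prob_space (P \<theta>)" and "t \<in> {0..<1}"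
  shows "\<P>(x in P \<theta>. p_value P H0 \<Phi> x \<le> t) \<le> t"
proof (rule dense_ge_bounded[of t 1])
  fix s assume s: "t < s" "s < 1"
  have "\<P>(x in P \<theta>. p_value P H0 \<Phi> x \<le> t) \<le> \<P>(x in P \<theta>. p_value P H0 \<Phi> x < s)"
    using s by (intro finite_measure_mono Collect_mono conj_mono) (auto, measurable)
  also have "\<dots> \<le> s"
    using assms s by (intro prob_p_value_less_le_null) auto
  finally show "\<P>(x in P \<theta>. p_value P H0 \<Phi> x \<le> t) \<le> s" .
qed (use assms in simp)

end

end

section \<open>Both error levels of the agnostic test\<close>

theorem mainTheorem4:
  fixes M :: "'x measure"
    and \<Theta> :: "'t topology"
    and P :: "'t \<Rightarrow> 'x measure"
    and H0 H1 :: "'t set"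
    and \<Phi> :: "('x \<Rightarrow> real) set"
    and p :: "'x \<Rightarrow> real"
    and \<alpha> \<beta> :: real
  assumes model: "\<And>\<theta>. \<theta> \<in> topspace \<Theta> \<Longrightarrow> prob_space (P \<theta>) \<and> sets (P \<theta>) = sets M"
    and H0: "H0 \<subset> topspace \<Theta>"
    and H1: "H1 = topspace \<Theta> - H0"
    and nested: "nested_family M P H0 \<Phi>"
    and unbiased: "\<And>\<phi>. \<phi> \<in> \<Phi> \<Longrightarrow> unbiased_test P H0 H1 \<phi>"
    and connected: "connected_space \<Theta>"
    and p: "p = p_value P H0 \<Phi>"
    and cont: "\<And>t::real. continuous_map \<Theta> euclideanreal (\<lambda>\<theta>. \<P>(x in P \<theta>. p x \<le> t))"
    and \<alpha>: "\<alpha> \<in> {0..1}"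
    and \<beta>: "\<beta> \<in> {0..1}"
    and sum_le: "\<alpha> + \<beta> \<le> 1"
  shows "level_test M P H0 H1 \<alpha> \<beta>
           (\<lambda>x. if p x \<ge> 1 - \<beta> then 0 else if p x < \<alpha> then 1 else 1/2)"
proof -
  let ?\<phi> = "\<lambda>x. if p x \<ge> 1 - \<beta> then 0 else if p x < \<alpha> then 1 else (1/2 :: real)"
  have ps: "prob_space (P \<theta>)" "sets (P \<theta>) = sets M" if "\<theta> \<in> topspace \<Theta>" for \<theta>
    using model that by auto
  have H0_ps: "prob_space (P \<theta>)" "sets (P \<theta>) = sets M" if "\<theta> \<in> H0" for \<theta>
    using ps H0 that by blast+
  have H1_ps: "prob_space (P \<theta>)" "sets (P \<theta>) = sets M" if "\<theta> \<in> H1" for \<theta>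
    using ps H1 that by blast+
  have ne: "H0 \<noteq> {}" "H1 \<noteq> {}"
    using nested_family_nonempty[OF nested] H0 H1 by auto
  have p_meas: "p \<in> borel_measurable M"
    unfolding p by (rule p_value_measurable[OF nested])
  \<comment> \<open>Unbiasedness enters here, as a pointwise lower bound on the power over
    \<open>H1\<close>.\<close>
  have reject: "type_I_size P H0 \<phi> \<le> \<P>(x in P \<theta>. \<phi> x = 1)" if "\<phi> \<in> \<Phi>" "\<theta> \<in> H1" for \<phi> \<theta>
  proof -
    have "(INF \<theta>\<in>H1. \<P>(x in P \<theta>. \<phi> x = 1)) \<le> \<P>(x in P \<theta>. \<phi> x = 1)"
      using that by (intro cINF_lower bdd_belowI[of _ 0]) auto
    with unbiased[OF that(1)] show ?thesis unfolding unbiased_test_def by linarith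
  qed
  have "?\<phi> \<in> measurable M (count_space {0, 1/2, 1})"
  proof (rule measurable_count_space_eq2[THEN iffD2], simp, intro conjI ballI)
    show "?\<phi> \<in> space M \<rightarrow> {0, 1/2, 1}" by auto
    have "?\<phi> \<in> borel_measurable M" using p_meas by measurable
    then show "?\<phi> -` {a} \<inter> space M \<in> sets M" for a by (rule measurable_sets) simp
  qed
  moreover have "type_I_size P H0 ?\<phi> = \<alpha>"
  proof -
    \<comment> \<open>Since \<open>\<alpha> \<le> 1 - \<beta>\<close>, the accepting branch cannot
      fire where \<open>p x < \<alpha>\<close>, although it is tested first.\<close>
    have one: "\<P>(x in P \<theta>. ?\<phi> x = 1) = \<P>(x in P \<theta>. p x < \<alpha>)" for \<theta>
      using sum_le by (intro arg_cong[where f = "measure (P \<theta>)"]) auto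
    have upper: "\<P>(x in P \<theta>. p x < \<alpha>) \<le> \<alpha>" if "\<theta> \<in> H0" for \<theta>
      using prob_p_value_less_le_null[OF nested H0_ps[OF that] that H0_ps(1) \<alpha>]
      unfolding p .
    then have bdd: "bdd_above ((\<lambda>\<theta>. \<P>(x in P \<theta>. p x < \<alpha>)) ` H0)"
      by (rule bdd_aboveI2)
    have "\<alpha> \<le> (SUP \<theta>\<in>H0. \<P>(x in P \<theta>. p x < \<alpha>))"
    \<comment> \<open>No size lies strictly between 0 and \<open>\<alpha>\<close> when
      \<open>\<alpha> = 0\<close>; there nonnegativity of a single probability suffices.\<close>
    proof (cases "\<alpha> = 0")
      case True
      then show ?thesis using ne bdd by (auto intro: cSUP_upper2)
    next
      case False
      show ?thesis
      proof (rule dense_le_bounded[of 0])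
        fix s assume s: "0 < s" "s < \<alpha>"
        with \<alpha> have "s \<in> {0..1}" by auto
        then obtain \<psi> where \<psi>: "\<psi> \<in> \<Phi>" "type_I_size P H0 \<psi> = s"
          by (rule nested_familyE[OF nested])
        have "(SUP \<theta>\<in>H0. \<P>(x in P \<theta>. \<psi> x = 1)) \<le> (SUP \<theta>\<in>H0. \<P>(x in P \<theta>. p x < \<alpha>))"
          using ne(1) bdd prob_reject_le_p_value_less[OF nested H0_ps \<psi>(1)] \<psi>(2) s(2)
          unfolding p by (intro cSUP_mono) blast+
        with \<psi>(2) show "s \<le> (SUP \<theta>\<in>H0. \<P>(x in P \<theta>. p x < \<alpha>))"
          unfolding type_I_size_def by simp
      qed (use False \<alpha> in auto)
    qed
    moreover have "(SUP \<theta>\<in>H0. \<P>(x in P \<theta>. p x < \<alpha>)) \<le> \<alpha>"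
      using ne(1) upper by (rule cSUP_least)
    ultimately show ?thesis unfolding type_I_size_def one by simp
  qed
  moreover have "type_II_size P H1 ?\<phi> = \<beta>"
  proof -
    have zero: "\<P>(x in P \<theta>. ?\<phi> x = 0) = 1 - \<P>(x in P \<theta>. p x < 1 - \<beta>)" if "\<theta> \<in> H1" for \<theta>
    proof -
      interpret prob_space "P \<theta>" using H1_ps that by blast
      have [measurable]: "p \<in> borel_measurable (P \<theta>)"
        unfolding measurable_cong_sets[OF H1_ps(2)[OF that] refl] by (rule p_meas)
      have "\<P>(x in P \<theta>. ?\<phi> x = 0) = \<P>(x in P \<theta>. \<not> p x < 1 - \<beta>)"
        by (intro arg_cong[where f = "measure (P \<theta>)"]) auto
      also have "\<dots> = 1 - \<P>(x in P \<theta>. p x < 1 - \<beta>)"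
        by (rule prob_neg) measurable
      finally show ?thesis .
    qed
    have lower: "1 - \<beta> \<le> \<P>(x in P \<theta>. p x < 1 - \<beta>)" if "\<theta> \<in> H1" for \<theta>
      using prob_p_value_less_ge[OF nested H1_ps[OF that] reject, of "1 - \<beta>"] that \<beta>
      unfolding p by simp
    have near: "\<exists>\<theta>\<in>H1. \<P>(x in P \<theta>. p x < 1 - \<beta>) < 1 - \<beta> + e" if "e > 0" for e
    \<comment> \<open>For \<open>\<beta> = 0\<close> the threshold is 1, outside the range of
      \<open>prob_p_value_le_null\<close>; any point of \<open>H1\<close> works, as probabilities
      are at most \<open>1 < 1 + e\<close>.\<close>
    proof (cases "\<beta> = 0")
      case True
      obtain \<theta> where "\<theta> \<in> H1" using ne(2) by blast
      moreover have "\<P>(x in P \<theta>. p x < 1 - \<beta>) \<le> 1"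
        using H1_ps(1) calculation by (blast intro: prob_space.prob_le_1)
      ultimately show ?thesis using True that by force
    next
      case False
      have null: "\<P>(x in P \<theta>. p x \<le> 1 - \<beta>) \<le> 1 - \<beta>" if "\<theta> \<in> H0" for \<theta>
        using prob_p_value_le_null[OF nested H0_ps[OF that] that H0_ps(1), of "1 - \<beta>"] False \<beta>
        unfolding p by simp
      \<comment> \<open>Continuity is assumed for \<open>p x \<le> t\<close>, so connectedness is
        applied to the non-strict event with \<open>A = H0\<close>; monotonicity then returns to the
        strict one.\<close>
      obtain \<theta> where \<theta>: "\<theta> \<in> H1" "\<P>(x in P \<theta>. p x \<le> 1 - \<beta>) < 1 - \<beta> + e"
        using connected_space_near_bound[OF connected cont _ ne(1) _ null \<open>e > 0\<close>] H0 H1 by blast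
      interpret prob_space "P \<theta>" using H1_ps \<theta> by blast
      have [measurable]: "p \<in> borel_measurable (P \<theta>)"
        unfolding measurable_cong_sets[OF H1_ps(2)[OF \<theta>(1)] refl] by (rule p_meas)
      have "\<P>(x in P \<theta>. p x < 1 - \<beta>) \<le> \<P>(x in P \<theta>. p x \<le> 1 - \<beta>)"
        by (rule finite_measure_mono) auto
      with \<theta> show ?thesis by force
    qed
    have "(SUP \<theta>\<in>H1. 1 - \<P>(x in P \<theta>. p x < 1 - \<beta>)) = \<beta>"
    \<comment> \<open>\<open>lower\<close> makes \<open>\<beta>\<close> an upper bound, and
      \<open>near\<close> shows that every upper bound is at least \<open>\<beta> - e\<close> for
      each \<open>e > 0\<close>.\<close>
    proof (rule cSup_eq_non_empty)
      fix y assume y: "\<And>z. z \<in> (\<lambda>\<theta>. 1 - \<P>(x in P \<theta>. p x < 1 - \<beta>)) ` H1 \<Longrightarrow> z \<le> y"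
      show "\<beta> \<le> y"
      proof (rule field_le_epsilon)
        fix e :: real assume "e > 0"
        with near obtain \<theta> where "\<theta> \<in> H1" "\<P>(x in P \<theta>. p x < 1 - \<beta>) < 1 - \<beta> + e" by blast
        then show "\<beta> \<le> y + e" using y[OF imageI, of \<theta>] by simp
      qed
    qed (use ne(2) lower in force)+
    then show ?thesis unfolding type_II_size_def using zero by (simp cong: SUP_cong)
  qed
  ultimately show ?thesis
    unfolding level_test_def agnostic_test_def by blast
qed

end
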